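(* Let $G=(V^+,V^-;E)$ be a bipartite graph with $|V^+|=|V^-|\ge 2$. Then \[\mathrm{opt}(G)=\max_{\mathcal X}\tau_G(\mathcal X),\] where the maximum is taken over all proper subpartitions $\mathcal X$ of $V^+$ and all proper subpartitions $\mathcal X$ of $V^-$, and \[\tau_G(\mathcal X):=\sum_{X\in\mathcal X}\bigl(|X|-|\Gamma_G(X)|+1\bigr).\]
   Context: A bipartite graph $G=(V^+,V^-;E)$ has finite disjoint vertex sides $V^+,V^-$, and its edge set satisfies $E\subseteq V^+\times V^-$ (no parallel edges). For $X\subseteq V^+$, $\Gamma_G(X)\subseteq V^-$ is the set of vertices adjacent to some vertex of $X$. For $X\subseteq V^-$, $\Gamma_G(X)\subseteq V^+$ is defined analogously. DM-decomposition. Define $f_G(X)=|\Gamma_G(X)|-|X|$ for $X\subseteq V^+$. Its minimizers form a lattice $\mathcal L$ closed under union and intersection. Take a maximal chain $X_0\subsetneq X_1\subsetneq\cdots\subsetneq X_k$ in $\mathcal L$ and set: - $V_0=X_0\cup\Gamma_G(X_0)$; - $V_i=(X_i\setminus X_{i-1})\cup(\Gamma_G(X_i)\setminus\Gamma_G(X_{i-1}))$ for $i=1,\dots,k$; - $V_\infty=(V^+\setminus X_k)\cup(V^-\setminus\Gamma_G(X_k))$. The partition $(V_0;V_1,\dots,V_k;V_\infty)$ of $V=V^+\cup V^-$ does not depend on the chain chosen; it is the DM-decomposition. $G$ is DM-irreducible if this decomposition has exactly one nonempty part, i.e. $V_0=V$, or $V_1=V$, or $V_\infty=V$. For $F\subseteq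 V^+\times V^-$, $G+F=(V^+,V^-;E\cup F)$. $\mathrm{opt}(G)$ is the minimum of $|F|$ over $F\subseteq (V^+\times V^-)\setminus E$ such that $G+F$ is DM-irreducible. A subpartition of a set $S$ is a family of pairwise disjoint nonempty subsets of $S$. It is proper if it is not $\{S\}$. *)

theory Defs
  imports Complex_Main "HOL-Library.Disjoint_Sets"
begin

record 'v bigraph =
  plus_side :: "'v set"
  minus_side :: "'v set"
  edges :: "('v \<times> 'v) set"

definition bipartite_graph :: "'v bigraph \<Rightarrow> bool" where
  "bipartite_graph G \<longleftrightarrow>
     finite (plus_side G) \<and> finite (minus_side G) \<and>
     plus_side G \<inter> minus_side G = {} \<and>
     edges G \<subseteq> plus_side G \<times> minus_side G"

definition vertices :: "'v bigraph \<Rightarrow> 'v set" where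
  "vertices G = plus_side G \<union> minus_side G"

text \<open>Edges are stored as pairs (plus vertex, minus vertex), but adjacency is symmetric: one
  operator serves as \<open>\<Gamma>\<close> for subsets of either side, and as the sides are disjoint it maps
  subsets of one side to subsets of the other.\<close>

definition nbhd :: "'v bigraph \<Rightarrow> 'v set \<Rightarrow> 'v set" where
  "nbhd G X = {v. \<exists>u\<in>X. (u, v) \<in> edges G \<or> (v, u) \<in> edges G}"

definition surplus :: "'v bigraph \<Rightarrow> 'v set \<Rightarrow> int" where
  "surplus G X = int (card (nbhd G X)) - int (card X)"

definition surplus_minimizers :: "'v bigraph \<Rightarrow> 'v set set" where
  "surplus_minimizers G =
     {X. X \<subseteq> plus_side G \<and> (\<forall>Y. Y \<subseteq> plus_side G \<longrightarrow> surplus G X \<le> surplus G Y)}"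

text \<open>The list \<open>Xs\<close> enumerates a maximal chain \<open>X\<^sub>0 \<subset> X\<^sub>1 \<subset> \<dots> \<subset> X\<^sub>k\<close> of minimizers in
  increasing order, so \<open>k = length Xs - 1\<close>; it is never empty, as a finite graph has a minimizer.\<close>

definition maximal_minimizer_chain :: "'v bigraph \<Rightarrow> 'v set list \<Rightarrow> bool" where
  "maximal_minimizer_chain G Xs \<longleftrightarrow>
     sorted_wrt (\<subset>) Xs \<and> subset.maxchain (surplus_minimizers G) (set Xs)"

definition DM_first :: "'v bigraph \<Rightarrow> 'v set list \<Rightarrow> 'v set" where
  "DM_first G Xs = Xs ! 0 \<union> nbhd G (Xs ! 0)"

definition DM_middle :: "'v bigraph \<Rightarrow> 'v set list \<Rightarrow> nat \<Rightarrow> 'v set" where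
  "DM_middle G Xs i =
     (Xs ! i - Xs ! (i - 1)) \<union> (nbhd G (Xs ! i) - nbhd G (Xs ! (i - 1)))"

definition DM_last :: "'v bigraph \<Rightarrow> 'v set list \<Rightarrow> 'v set" where
  "DM_last G Xs = (plus_side G - last Xs) \<union> (minus_side G - nbhd G (last Xs))"

text \<open>The list \<open>[V\<^sub>0, V\<^sub>1, \<dots>, V\<^sub>k, V\<^sub>\<infinity>]\<close>.\<close>

definition DM_parts :: "'v bigraph \<Rightarrow> 'v set list \<Rightarrow> 'v set list" where
  "DM_parts G Xs =
     DM_first G Xs # map (DM_middle G Xs) [1..<length Xs] @ [DM_last G Xs]"

text \<open>The decomposition does not depend on the maximal chain, so it is immaterial that the
  chain is quantified existentially here.\<close>

definition DM_irreducible :: "'v bigraph \<Rightarrow> bool" where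
  "DM_irreducible G \<longleftrightarrow>
     (\<exists>Xs. maximal_minimizer_chain G Xs \<and>
        (\<exists>!i. i < length (DM_parts G Xs) \<and> DM_parts G Xs ! i \<noteq> {}))"

definition add_edges :: "'v bigraph \<Rightarrow> ('v \<times> 'v) set \<Rightarrow> 'v bigraph" where
  "add_edges G F = G\<lparr>edges := edges G \<union> F\<rparr>"

definition opt :: "'v bigraph \<Rightarrow> nat" where
  "opt G = Min {card F | F. F \<subseteq> (plus_side G \<times> minus_side G) - edges G \<and>
                           DM_irreducible (add_edges G F)}"

text \<open>The empty family counts as a subpartition.\<close>

definition subpartition :: "'v set \<Rightarrow> 'v set set \<Rightarrow> bool" where
  "subpartition S \<X> \<longleftrightarrow> \<X> \<subseteq> Pow S \<and> {} \<notin> \<X> \<and> disjoint \<X>"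

definition proper_subpartition :: "'v set \<Rightarrow> 'v set set \<Rightarrow> bool" where
  "proper_subpartition S \<X> \<longleftrightarrow> subpartition S \<X> \<and> \<X> \<noteq> {S}"

definition tau :: "'v bigraph \<Rightarrow> 'v set set \<Rightarrow> int" where
  "tau G \<X> = (\<Sum>X\<in>\<X>. int (card X) - int (card (nbhd G X)) + 1)"

end

theory Submission
  imports Defs
begin

text \<open>
  Write \<open>p X = |X| - |\<Gamma> X| + 1\<close>.  On at least two vertices per side, DM-irreducibility means
  \<open>p X \<le> 0\<close> for every nonempty \<open>X \<subset> V\<^sup>+\<close>, a condition symmetric in the two sides; counting the new
  edges at the blocks of a proper subpartition gives the lower bound.  If the graph is not
  irreducible, the improper families \<open>{V\<^sup>+}\<close> and \<open>{V\<^sup>-}\<close> do not exceed the maximum \<open>T\<close> either, so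
  properness can be dropped, and it suffices to find, while \<open>T \<ge> 2\<close>, an edge whose addition lowers
  \<open>\<tau>\<close> of all optimal families on both sides (for \<open>T = 1\<close> one edge makes the graph irreducible).

  Since \<open>p\<close> is supermodular, every minimal nonempty set with \<open>p \<ge> 1\<close> lies inside a block of each
  optimal family, and each side with an optimal family has a coarsest one, whose blocks have
  disjoint neighbourhoods.  So it is enough to join a vertex \<open>u\<close> of a minimal set inside
  a block \<open>X\<close> of the coarsest family in \<open>V\<^sup>+\<close> to a vertex \<open>v\<close> of a minimal set inside a block \<open>Y\<close> of
  the one in \<open>V\<^sup>-\<close> such that \<open>v \<notin> \<Gamma> X\<close> and \<open>u \<notin> \<Gamma> Y\<close>.  That such a pair exists follows from
  \<open>p X + p Y \<le> p (X - \<Gamma> Y) + p (Y - \<Gamma> X)\<close>.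
\<close>

section \<open>Neighbourhoods and the excess of a vertex set\<close>

definition excess :: "'v bigraph \<Rightarrow> 'v set \<Rightarrow> int" where
  "excess G X = int (card X) - int (card (nbhd G X)) + 1"

lemma tau_eq_sum_excess: "tau G \<X> = sum (excess G) \<X>"
  by (simp add: tau_def excess_def)

lemma nbhd_empty [simp]: "nbhd G {} = {}"
  by (simp add: nbhd_def)

text \<open>The value 1 at the empty set is what makes supermodularity hold for disjoint pairs as
  well.\<close>

lemma excess_empty [simp]: "excess G {} = 1"
  by (simp add: excess_def)

lemma nbhd_Un: "nbhd G (X \<union> Y) = nbhd G X \<union> nbhd G Y"
  by (auto simp: nbhd_def)

lemma nbhd_mono: "X \<subseteq> Y \<Longrightarrow> nbhd G X \<subseteq> nbhd G Y"
  by (auto simp: nbhd_def)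

lemma nbhd_sym: "x \<in> nbhd G {y} \<longleftrightarrow> y \<in> nbhd G {x}"
  by (auto simp: nbhd_def)

lemma nbhd_iff: "x \<in> nbhd G X \<longleftrightarrow> (\<exists>y\<in>X. x \<in> nbhd G {y})"
  by (auto simp: nbhd_def)

text \<open>An edge from \<open>x\<close> to a vertex of \<open>Y\<close> would put \<open>x\<close>
  into \<open>nbhd G Y\<close>. Both the uncrossing across the sides and the passage to complements
  rest on this.\<close>

lemma nbhd_Diff_nbhd: "nbhd G (X - nbhd G Y) \<subseteq> nbhd G X - Y"
proof
  fix v assume "v \<in> nbhd G (X - nbhd G Y)"
  then obtain x where x: "x \<in> X" "x \<notin> nbhd G Y" "v \<in> nbhd G {x}"
    using nbhd_iff[of v] by blast
  then have "v \<notin> Y" using nbhd_sym[of v G x] nbhd_iff[of x G Y] by blast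
  with x show "v \<in> nbhd G X - Y" using nbhd_iff[of v G X] by blast
qed

section \<open>Exchanging blocks of a subpartition\<close>

lemma subpartition_disjoint:
  "subpartition S \<X> \<Longrightarrow> X \<in> \<X> \<Longrightarrow> Y \<in> \<X> \<Longrightarrow> X \<noteq> Y \<Longrightarrow> X \<inter> Y = {}"
  unfolding subpartition_def by (meson disjointD)

text \<open>The common tool of all exchange arguments. Blocks are nonempty, so \<open>dis\<close>
  also rules out a block shared by \<open>\<X> - H\<close> and \<open>\<Z>\<close>, and the sum
  splits exactly.\<close>

lemma subpartition_exchange:
  assumes "finite S" and \<X>: "subpartition S \<X>" and "H \<subseteq> \<X>" and \<Z>: "subpartition S \<Z>"
    and dis: "\<And>X Z. X \<in> \<X> - H \<Longrightarrow> Z \<in> \<Z> \<Longrightarrow> X \<inter> Z = {}"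
  shows "subpartition S ((\<X> - H) \<union> \<Z>)"
    and "tau G ((\<X> - H) \<union> \<Z>) = tau G \<X> - tau G H + tau G \<Z>"
proof -
  have "disjoint ((\<X> - H) \<union> \<Z>)"
  proof (rule disjointI)
    fix X Y assume "X \<in> (\<X> - H) \<union> \<Z>" "Y \<in> (\<X> - H) \<union> \<Z>" "X \<noteq> Y"
    then show "X \<inter> Y = {}"
      using dis[of X Y] dis[of Y X] subpartition_disjoint[OF \<X>] subpartition_disjoint[OF \<Z>]
      by blast
  qed
  then show "subpartition S ((\<X> - H) \<union> \<Z>)"
    using \<X> \<Z> unfolding subpartition_def by auto
  have fin: "finite \<X>" "finite \<Z>"
    using assms by (meson finite_Pow_iff finite_subset subpartition_def)+
  have "X \<notin> \<Z>" if "X \<in> \<X> - H" for X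
    using dis[OF that, of X] \<Z> unfolding subpartition_def by auto
  then have "(\<X> - H) \<inter> \<Z> = {}" by blast
  then have "tau G ((\<X> - H) \<union> \<Z>) = tau G (\<X> - H) + tau G \<Z>"
    unfolding tau_eq_sum_excess using fin by (simp add: sum.union_disjoint)
  moreover have "tau G (\<X> - H) = tau G \<X> - tau G H"
    unfolding tau_eq_sum_excess using fin \<open>H \<subseteq> \<X>\<close> finite_subset sum_diff by blast
  ultimately show "tau G ((\<X> - H) \<union> \<Z>) = tau G \<X> - tau G H + tau G \<Z>" by simp
qed

lemma subpartition_single: "X \<subseteq> S \<Longrightarrow> X \<noteq> {} \<Longrightarrow> subpartition S {X}"
  by (auto simp: subpartition_def)

lemma subpartition_subset: "subpartition S \<X> \<Longrightarrow> \<Y> \<subseteq> \<X> \<Longrightarrow> subpartition S \<Y>"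
  unfolding subpartition_def by (auto intro: pairwise_subset)

lemma tau_single: "tau G {X} = excess G X"
  by (simp add: tau_eq_sum_excess)

text \<open>The two sides appear as parameters \<open>A\<close>, \<open>B\<close>, so that every lemma holds with the sides
  exchanged.\<close>

locale balanced_bipartite =
  fixes G :: "'v bigraph" and A B :: "'v set"
  assumes bip: "bipartite_graph G"
    and sides: "A = plus_side G \<and> B = minus_side G \<or> A = minus_side G \<and> B = plus_side G"
    and card_eq: "card A = card B"
begin

lemma flip: "balanced_bipartite G B A"
  using bip sides card_eq by unfold_locales auto

lemma fin: "finite A" "finite B"
  using bip sides by (auto simp: bipartite_graph_def)

lemma sides_disjoint: "A \<inter> B = {}"
  using bip sides by (auto simp: bipartite_graph_def)

lemma nbhd_subset: "X \<subseteq> A \<Longrightarrow> nbhd G X \<subseteq> B"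
  using bip sides by (auto simp: bipartite_graph_def nbhd_def)

lemma fin_nbhd: "X \<subseteq> A \<Longrightarrow> finite (nbhd G X)"
  using nbhd_subset fin finite_subset by blast

section \<open>Inequalities for the excess\<close>

lemma excess_le:
  assumes "X \<subseteq> A" "nbhd G X \<subseteq> N" "N \<subseteq> B"
  shows "int (card X) - int (card N) + 1 \<le> excess G X"
  using card_mono[of N "nbhd G X"] assms fin finite_subset unfolding excess_def by fastforce

text \<open>Neighbourhoods commute with unions, while that of an intersection is only contained in
  the intersection of the neighbourhoods; counting is modular.\<close>

lemma excess_supermodular:
  assumes "X \<subseteq> A" "Y \<subseteq> A"
  shows "excess G X + excess G Y \<le> excess G (X \<union> Y) + excess G (X \<inter> Y)"
proof -
  have f: "finite X" "finite Y" using assms fin finite_subset by blast+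
  have "nbhd G (X \<inter> Y) \<subseteq> nbhd G X \<inter> nbhd G Y"
    by (simp add: nbhd_mono)
  then have "int (card (X \<inter> Y)) - int (card (nbhd G X \<inter> nbhd G Y)) + 1 \<le> excess G (X \<inter> Y)"
    using assms nbhd_subset by (intro excess_le) auto
  moreover have "card (nbhd G X) + card (nbhd G Y)
      = card (nbhd G (X \<union> Y)) + card (nbhd G X \<inter> nbhd G Y)"
    using card_Un_Int[OF fin_nbhd[OF assms(1)] fin_nbhd[OF assms(2)]] by (simp add: nbhd_Un)
  ultimately show ?thesis
    using card_Un_Int[OF f] unfolding excess_def by linarith
qed

text \<open>Merging loses one of the two summands 1, and a common neighbour, counted twice on the
  left, makes up for it.\<close>

lemma excess_Un_disjoint:
  assumes "X \<subseteq> A" "Y \<subseteq> A" "X \<inter> Y = {}" "nbhd G X \<inter> nbhd G Y \<noteq> {}"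
  shows "excess G X + excess G Y \<le> excess G (X \<union> Y)"
proof -
  have f: "finite X" "finite Y" using assms fin finite_subset by blast+
  have "card (nbhd G X \<inter> nbhd G Y) \<ge> 1"
    using assms(4) fin_nbhd[OF assms(1)] by (simp add: Suc_le_eq card_gt_0_iff)
  moreover have "card (nbhd G X) + card (nbhd G Y)
      = card (nbhd G (X \<union> Y)) + card (nbhd G X \<inter> nbhd G Y)"
    using card_Un_Int[OF fin_nbhd[OF assms(1)] fin_nbhd[OF assms(2)]] by (simp add: nbhd_Un)
  ultimately show ?thesis
    using card_Un_Int[OF f] assms(3) unfolding excess_def by simp
qed

text \<open>Deleting \<open>X \<inter> nbhd G Y\<close> shrinks \<open>X\<close> and the
  neighbourhood bound for \<open>Y\<close> by the same amount, and symmetrically for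
  \<open>Y \<inter> nbhd G X\<close>, so the losses cancel in the sum.\<close>

lemma excess_cross:
  assumes X: "X \<subseteq> A" and Y: "Y \<subseteq> B"
  shows "excess G X + excess G Y \<le> excess G (X - nbhd G Y) + excess G (Y - nbhd G X)"
proof -
  interpret fl: balanced_bipartite G B A by (rule flip)
  have f: "finite X" "finite Y" using assms fin finite_subset by blast+
  have "int (card (X - nbhd G Y)) - int (card (nbhd G X - Y)) + 1 \<le> excess G (X - nbhd G Y)"
    using X nbhd_subset by (intro excess_le nbhd_Diff_nbhd) auto
  moreover have "int (card (Y - nbhd G X)) - int (card (nbhd G Y - X)) + 1
      \<le> excess G (Y - nbhd G X)"
    using Y fl.nbhd_subset by (intro fl.excess_le nbhd_Diff_nbhd) auto
  moreover have "card X = card (X - nbhd G Y) + card (X \<inter> nbhd G Y)"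
    "card (nbhd G Y) = card (nbhd G Y - X) + card (X \<inter> nbhd G Y)"
    "card Y = card (Y - nbhd G X) + card (Y \<inter> nbhd G X)"
    "card (nbhd G X) = card (nbhd G X - Y) + card (Y \<inter> nbhd G X)"
    using f fin_nbhd[OF X] fl.fin_nbhd[OF Y]
    by (metis card_Int_Diff add.commute inf_commute)+
  ultimately show ?thesis unfolding excess_def by linarith
qed

text \<open>The neighbourhood of the complement avoids \<open>X\<close>, and since the sides have
  equal size, \<open>|B - nbhd G X| - |A - X| = |X| - |nbhd G X|\<close>.\<close>

lemma excess_complement:
  assumes "X \<subseteq> A"
  shows "excess G X \<le> excess G (B - nbhd G X)"
proof -
  interpret fl: balanced_bipartite G B A by (rule flip)
  have "nbhd G (B - nbhd G X) \<subseteq> A - X"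
    using nbhd_Diff_nbhd[of G B X] fl.nbhd_subset by blast
  then have "int (card (B - nbhd G X)) - int (card (A - X)) + 1 \<le> excess G (B - nbhd G X)"
    by (intro fl.excess_le) auto
  moreover have "card (A - X) = card A - card X" "card X \<le> card A"
    using assms fin by (auto simp: card_Diff_subset finite_subset card_mono)
  moreover have "card (B - nbhd G X) = card B - card (nbhd G X)" "card (nbhd G X) \<le> card B"
    using nbhd_subset[OF assms] fin fin_nbhd[OF assms]
    by (auto simp: card_Diff_subset card_mono)
  ultimately show ?thesis using card_eq unfolding excess_def by linarith
qed

text \<open>Supermodularity applied to one block of \<open>H\<close> at a time; by disjointness each
  block meets the union built so far only in its trace on \<open>Z\<close>.\<close>

lemma excess_Union_hits:
  assumes "finite H" "H \<subseteq> Pow A" "Z \<subseteq> A" "disjoint H"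
  shows "excess G Z + sum (excess G) H \<le> excess G (Z \<union> \<Union>H) + (\<Sum>X\<in>H. excess G (X \<inter> Z))"
  using assms
proof (induction H)
  case (insert X H)
  have dis: "X \<inter> \<Union>H = {}"
    using insert.prems insert.hyps by (auto simp: disjoint_def)
  then have "X \<inter> (Z \<union> \<Union>H) = X \<inter> Z" by blast
  moreover have "Z \<union> \<Union>H \<subseteq> A" "X \<subseteq> A" using insert.prems by auto
  ultimately have "excess G X + excess G (Z \<union> \<Union>H)
      \<le> excess G (Z \<union> \<Union>(insert X H)) + excess G (X \<inter> Z)"
    using excess_supermodular[of X "Z \<union> \<Union>H"] by (simp add: Un_left_commute)
  moreover have "disjoint H" using insert.prems by (auto simp: disjoint_def)
  ultimately show ?case using insert by simp
qed simp

section \<open>Optimal subpartitions\<close>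

text \<open>\<open>T\<close> is a parameter rather than the maximum for this side, because one bound
  serves both sides and may be attained on only one of them.\<close>

definition bounded :: "int \<Rightarrow> bool" where
  "bounded T \<longleftrightarrow> (\<forall>\<X>. subpartition A \<X> \<longrightarrow> tau G \<X> \<le> T)"

definition optimal :: "int \<Rightarrow> 'v set set \<Rightarrow> bool" where
  "optimal T \<X> \<longleftrightarrow> subpartition A \<X> \<and> tau G \<X> = T"

definition min_bad :: "'v set \<Rightarrow> bool" where
  "min_bad S \<longleftrightarrow> S \<subseteq> A \<and> S \<noteq> {} \<and> excess G S \<ge> 1
     \<and> (\<forall>Z. Z \<subset> S \<longrightarrow> Z \<noteq> {} \<longrightarrow> excess G Z \<le> 0)"

lemma min_bad_exists:
  assumes "X \<subseteq> A" "X \<noteq> {}" "excess G X \<ge> 1"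
  obtains S where "S \<subseteq> X" "min_bad S"
proof -
  have "finite X" using assms fin finite_subset by blast
  then have "X \<subseteq> A \<Longrightarrow> X \<noteq> {} \<Longrightarrow> excess G X \<ge> 1 \<Longrightarrow> \<exists>S\<subseteq>X. min_bad S"
  proof (induction X rule: finite_psubset_induct)
    case (psubset X)
    show ?case
    proof (cases "min_bad X")
      case False
      then obtain Z where "Z \<subset> X" "Z \<noteq> {}" "excess G Z \<ge> 1"
        using psubset.prems unfolding min_bad_def by (metis int_one_le_iff_zero_less not_le)
      then show ?thesis using psubset.IH[of Z] psubset.prems by blast
    qed blast
  qed
  then show ?thesis using assms that by blast
qed

lemma fin_subpartition: "subpartition A \<X> \<Longrightarrow> finite \<X>"
  using fin by (meson finite_Pow_iff finite_subset subpartition_def)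

text \<open>Merges \<open>Z\<close> with all the blocks that it meets. If it meets none,
  \<open>Z\<close> becomes a block of its own.\<close>

lemma subpartition_hits_exchange:
  fixes Z \<X> defines "H \<equiv> {X \<in> \<X>. X \<inter> Z \<noteq> {}}"
  assumes "subpartition A \<X>" "Z \<subseteq> A" "Z \<noteq> {}"
  shows "subpartition A ((\<X> - H) \<union> {Z \<union> \<Union>H})"
    and "tau G ((\<X> - H) \<union> {Z \<union> \<Union>H})
      \<ge> tau G \<X> + excess G Z - (\<Sum>X\<in>H. excess G (X \<inter> Z))"
proof -
  have H: "H \<subseteq> \<X>" "subpartition A H" using assms by (auto intro: subpartition_subset)
  then have sub: "Z \<union> \<Union>H \<subseteq> A" "Z \<union> \<Union>H \<noteq> {}" using assms unfolding subpartition_def by auto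
  have dis: "X \<inter> W = {}" if "X \<in> \<X> - H" "W \<in> {Z \<union> \<Union>H}" for X W
  proof -
    have "X \<inter> Y = {}" if "Y \<in> H" for Y
      using \<open>X \<in> \<X> - H\<close> that subpartition_disjoint[OF assms(2)] H(1) by blast
    moreover have "X \<inter> Z = {}" using that by (auto simp: H_def)
    ultimately show ?thesis using that by blast
  qed
  note ex = subpartition_exchange[OF fin(1) assms(2) H(1) subpartition_single[OF sub] dis]
  show "subpartition A ((\<X> - H) \<union> {Z \<union> \<Union>H})" by (rule ex)
  have "excess G Z + sum (excess G) H \<le> excess G (Z \<union> \<Union>H) + (\<Sum>X\<in>H. excess G (X \<inter> Z))"
    using H assms(3) fin_subpartition[OF H(2)]
    by (intro excess_Union_hits) (auto simp: subpartition_def)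
  then show "tau G ((\<X> - H) \<union> {Z \<union> \<Union>H})
      \<ge> tau G \<X> + excess G Z - (\<Sum>X\<in>H. excess G (X \<inter> Z))"
    using ex(2)[of G] by (simp add: tau_eq_sum_excess)
qed

text \<open>If no block contains \<open>S\<close>, its traces on the blocks it meets are proper
  nonempty subsets of \<open>S\<close>, with excess at most 0 by minimality. Merging
  \<open>S\<close> with these blocks would then push the value above \<open>T\<close>.\<close>

lemma min_bad_in_optimal:
  assumes "bounded T" "optimal T \<X>" "min_bad S"
  obtains X where "X \<in> \<X>" "S \<subseteq> X"
proof (rule ccontr)
  assume *: "\<not> thesis"
  define H where "H = {X \<in> \<X>. X \<inter> S \<noteq> {}}"
  have sub: "subpartition A \<X>" and S: "S \<subseteq> A" "S \<noteq> {}" "excess G S \<ge> 1"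
    using assms by (auto simp: optimal_def min_bad_def)
  have "excess G (X \<inter> S) \<le> 0" if "X \<in> H" for X
  proof -
    have "X \<inter> S \<subset> S" using that * \<open>\<And>X. X \<in> \<X> \<Longrightarrow> S \<subseteq> X \<Longrightarrow> thesis\<close> by (auto simp: H_def)
    then show ?thesis using assms(3) that by (auto simp: min_bad_def H_def)
  qed
  then have "(\<Sum>X\<in>H. excess G (X \<inter> S)) \<le> 0" by (simp add: sum_nonpos)
  then have "tau G ((\<X> - H) \<union> {S \<union> \<Union>H}) > T"
    using subpartition_hits_exchange(2)[OF sub S(1,2)] S assms(2)
    unfolding H_def optimal_def by linarith
  moreover have "tau G ((\<X> - H) \<union> {S \<union> \<Union>H}) \<le> T"
    using subpartition_hits_exchange(1)[OF sub S(1,2)] assms(1)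
    unfolding H_def bounded_def by blast
  ultimately show False by simp
qed

text \<open>Shrinking one block leaves a subpartition, whose value is again at most
  \<open>T\<close>.\<close>

lemma optimal_replace:
  assumes "bounded T" "optimal T \<X>" "X \<in> \<X>" "Z \<subseteq> X" "Z \<noteq> {}"
  shows "excess G Z \<le> excess G X"
    and "excess G Z = excess G X \<Longrightarrow> optimal T ((\<X> - {X}) \<union> {Z})"
proof -
  have sub: "subpartition A \<X>" using assms by (simp add: optimal_def)
  then have Z: "Z \<subseteq> A" using assms unfolding subpartition_def by blast
  have dis: "X' \<inter> W = {}" if "X' \<in> \<X> - {X}" "W \<in> {Z}" for X' W
  proof -
    have "X' \<inter> X = {}" using that subpartition_disjoint[OF sub] assms(3) by blast
    then show ?thesis using that assms(4) by blast
  qed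
  have 1: "{X} \<subseteq> \<X>" using assms by simp
  note ex = subpartition_exchange[OF fin(1) sub 1 subpartition_single[OF Z assms(5)] dis]
  have t: "tau G ((\<X> - {X}) \<union> {Z}) = T - excess G X + excess G Z"
    using ex(2)[of G] assms(2) by (simp add: tau_single optimal_def)
  then show "excess G Z \<le> excess G X"
    using ex(1) assms(1) unfolding bounded_def by (smt (verit))
  show "optimal T ((\<X> - {X}) \<union> {Z})" if "excess G Z = excess G X"
    using ex(1) t that unfolding optimal_def by simp
qed

text \<open>Cutting the block \<open>X'\<close> into its traces on \<open>H\<close> gives a
  subpartition, so it cannot gain. The traces are disjoint and nonempty, hence distinct, and may be
  summed over \<open>H\<close>.\<close>

lemma optimal_split:
  assumes "bounded T" "optimal T \<X>" "X' \<in> \<X>" "subpartition A H"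
    and "\<And>X. X \<in> H \<Longrightarrow> X \<inter> X' \<noteq> {}"
  shows "(\<Sum>X\<in>H. excess G (X \<inter> X')) \<le> excess G X'"
proof -
  let ?Z = "(\<lambda>X. X \<inter> X') ` H"
  have sub: "subpartition A \<X>" using assms by (simp add: optimal_def)
  have dH: "X \<inter> Y = {}" if "X \<in> H" "Y \<in> H" "X \<noteq> Y" for X Y
    using subpartition_disjoint[OF assms(4)] that by blast
  have inj: "inj_on (\<lambda>X. X \<inter> X') H"
  proof (rule inj_onI, rule ccontr)
    fix X Y assume "X \<in> H" "Y \<in> H" "X \<inter> X' = Y \<inter> X'" "X \<noteq> Y"
    then show False using dH[of X Y] assms(5)[of X] by auto
  qed
  have "disjoint ?Z"
  proof (rule disjointI)
    fix U V assume "U \<in> ?Z" "V \<in> ?Z" "U \<noteq> V"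
    then show "U \<inter> V = {}" using dH by blast
  qed
  then have Z: "subpartition A ?Z"
    using assms(4,5) unfolding subpartition_def by auto
  have dis: "X \<inter> W = {}" if "X \<in> \<X> - {X'}" "W \<in> ?Z" for X W
    using that subpartition_disjoint[OF sub] assms(3) by blast
  have 1: "{X'} \<subseteq> \<X>" using assms by simp
  note ex = subpartition_exchange[OF fin(1) sub 1 Z dis]
  have "tau G ?Z = (\<Sum>X\<in>H. excess G (X \<inter> X'))"
    unfolding tau_eq_sum_excess by (simp add: sum.reindex[OF inj])
  moreover have "tau G ((\<X> - {X'}) \<union> ?Z) \<le> T"
    using ex(1) assms(1) unfolding bounded_def by blast
  ultimately show ?thesis
    using ex(2)[of G] assms(2) by (simp add: tau_single optimal_def)
qed

text \<open>The last conjunct allows one edge to be tested against all optimal families at once: a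
  block meeting \<open>X\<close> lies inside \<open>X\<close> and has no neighbours outside
  \<open>nbhd G X\<close>.\<close>

definition coarsest :: "int \<Rightarrow> 'v set set \<Rightarrow> bool" where
  "coarsest T \<X> \<longleftrightarrow> optimal T \<X> \<and> (\<forall>X\<in>\<X>. excess G X \<ge> 1)
     \<and> (\<forall>X\<in>\<X>. \<forall>Y\<in>\<X>. X \<noteq> Y \<longrightarrow> nbhd G X \<inter> nbhd G Y = {})
     \<and> (\<forall>\<X>' X' X. optimal T \<X>' \<longrightarrow> X' \<in> \<X>' \<longrightarrow> X \<in> \<X> \<longrightarrow> X \<inter> X' \<noteq> {} \<longrightarrow> X' \<subseteq> X)"

lemma coarsestD:
  assumes "coarsest T \<X>" "X \<in> \<X>"
  shows "optimal T \<X>" "excess G X \<ge> 1"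
    "Y \<in> \<X> \<Longrightarrow> X \<noteq> Y \<Longrightarrow> nbhd G X \<inter> nbhd G Y = {}"
    "optimal T \<X>' \<Longrightarrow> X' \<in> \<X>' \<Longrightarrow> X \<inter> X' \<noteq> {} \<Longrightarrow> X' \<subseteq> X"
  using assms unfolding coarsest_def by metis+

text \<open>Enlarging blocks enlarges the relation of lying in a common block, so an optimal family
  for which that relation is maximal absorbs every block of an optimal family that it meets.\<close>

lemma coarsest_exists:
  assumes "bounded T" "optimal T \<X>\<^sub>0"
  obtains \<X> where "coarsest T \<X>"
proof -
  let ?rel = "\<lambda>\<X> :: 'v set set. \<Union>X\<in>\<X>. X \<times> X"
  let ?P = "\<lambda>\<X>. optimal T \<X> \<and> (\<forall>X\<in>\<X>. excess G X \<ge> 1)"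
  \<comment> \<open>Discarding blocks of nonpositive excess cannot lower the value, so the remaining
    family is still optimal.\<close>
  define H0 where "H0 = {X \<in> \<X>\<^sub>0. excess G X \<le> 0}"
  have sub0: "subpartition A \<X>\<^sub>0" using assms by (simp add: optimal_def)
  have "tau G ((\<X>\<^sub>0 - H0) \<union> {}) = tau G \<X>\<^sub>0 - tau G H0 + tau G {}"
    "subpartition A ((\<X>\<^sub>0 - H0) \<union> {})"
    by (rule subpartition_exchange[OF fin(1) sub0]; auto simp: H0_def subpartition_def)+
  moreover have "tau G H0 \<le> 0"
    unfolding tau_eq_sum_excess by (rule sum_nonpos) (simp add: H0_def)
  ultimately have "optimal T (\<X>\<^sub>0 - H0)"
    using assms unfolding optimal_def bounded_def by (auto simp: tau_def intro: antisym)
  then have P0: "?P (\<X>\<^sub>0 - H0)" by (auto simp: H0_def)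
  have "card (?rel \<X>) \<le> card (A \<times> A)" if "?P \<X>" for \<X>
  proof (rule card_mono)
    show "?rel \<X> \<subseteq> A \<times> A" using that unfolding optimal_def subpartition_def by blast
  qed (simp add: fin)
  then have "\<forall>\<X>. ?P \<X> \<longrightarrow> card (?rel \<X>) < Suc (card (A \<times> A))"
    unfolding less_Suc_eq_le by blast
  from ex_has_greatest_nat[of ?P _ "\<lambda>\<X>. card (?rel \<X>)", OF P0 this]
  obtain \<X> where P: "?P \<X>" and max: "\<And>\<Y>. ?P \<Y> \<Longrightarrow> card (?rel \<Y>) \<le> card (?rel \<X>)"
    by blast
  have opt: "optimal T \<X>" and pos: "\<And>X. X \<in> \<X> \<Longrightarrow> excess G X \<ge> 1" using P by auto
  have sub: "subpartition A \<X>" using opt by (simp add: optimal_def)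
  \<comment> \<open>Replacing \<open>H\<close> by \<open>U\<close> only enlarges the relation, so
    maximality forces equality. Each point of \<open>U\<close> then shares a block of
    \<open>\<X>\<close> with a point of \<open>X\<close>, and that block is
    \<open>X\<close>.\<close>
  have absorb: "U \<subseteq> X" if U: "?P ((\<X> - H) \<union> {U})" "\<Union>H \<subseteq> U" and "X \<in> H" and "H \<subseteq> \<X>" for U H X
  proof -
    let ?Y = "(\<X> - H) \<union> {U}"
    have "?rel ?Y \<subseteq> A \<times> A" using U unfolding optimal_def subpartition_def by blast
    then have "finite (?rel ?Y)" using fin finite_subset by blast
    moreover have le: "?rel \<X> \<subseteq> ?rel ?Y" using U(2) by blast
    ultimately have "?rel \<X> = ?rel ?Y" using max[OF U(1)] by (intro card_seteq)
    then have UU: "U \<times> U \<subseteq> ?rel \<X>" by blast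
    have "X \<in> \<X>" using that by blast
    then have "X \<noteq> {}" using sub unfolding subpartition_def by blast
    then obtain x where x: "x \<in> X" by blast
    show ?thesis
    proof
      fix y assume "y \<in> U"
      then have "(x, y) \<in> ?rel \<X>" using UU x that by blast
      then obtain Y where Y: "Y \<in> \<X>" "x \<in> Y" "y \<in> Y" by blast
      then have "Y = X" using x \<open>X \<in> \<X>\<close> subpartition_disjoint[OF sub] by blast
      then show "y \<in> X" using Y by simp
    qed
  qed
  have "coarsest T \<X>"
    unfolding coarsest_def
  proof (intro conjI ballI allI impI opt pos)
    fix X Y assume XY: "X \<in> \<X>" "Y \<in> \<X>" "X \<noteq> Y"
    show "nbhd G X \<inter> nbhd G Y = {}"
    proof (rule ccontr)
      assume meet: "nbhd G X \<inter> nbhd G Y \<noteq> {}"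
      have XYA: "X \<subseteq> A" "Y \<subseteq> A" "X \<inter> Y = {}" "X \<noteq> {}" "Y \<noteq> {}"
        using XY sub subpartition_disjoint[OF sub XY] unfolding subpartition_def by auto
      have ge: "excess G X + excess G Y \<le> excess G (X \<union> Y)"
        using excess_Un_disjoint XYA meet by blast
      have a: "{X, Y} \<subseteq> \<X>" "X \<union> Y \<subseteq> A" "X \<union> Y \<noteq> {}" using XY XYA by auto
      have dis: "Z \<inter> W = {}" if "Z \<in> \<X> - {X, Y}" "W \<in> {X \<union> Y}" for Z W
        using that subpartition_disjoint[OF sub] XY by blast
      note ex = subpartition_exchange[OF fin(1) sub a(1) subpartition_single[OF a(2,3)] dis]
      have "tau G {X, Y} = excess G X + excess G Y"
        using XY(3) by (simp add: tau_eq_sum_excess)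
      then have "tau G ((\<X> - {X, Y}) \<union> {X \<union> Y}) \<ge> T"
        using ex(2)[of G] ge opt by (simp add: tau_single optimal_def)
      then have "optimal T ((\<X> - {X, Y}) \<union> {X \<union> Y})"
        using ex(1) assms(1) unfolding optimal_def bounded_def by (blast intro: antisym)
      moreover have "excess G (X \<union> Y) \<ge> 1" using ge pos XY by (smt (verit))
      ultimately have "X \<union> Y \<subseteq> X"
        using pos a(1) by (intro absorb[of "{X, Y}" "X \<union> Y" X]) auto
      then show False using XYA by blast
    qed
  next
    fix \<X>' X' X assume *: "optimal T \<X>'" "X' \<in> \<X>'" "X \<in> \<X>" "X \<inter> X' \<noteq> {}"
    define H where "H = {X \<in> \<X>. X \<inter> X' \<noteq> {}}"
    have X': "X' \<subseteq> A" "X' \<noteq> {}" using * unfolding optimal_def subpartition_def by auto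
    have H: "subpartition A H" "H \<subseteq> \<X>" "X \<in> H"
      using sub * by (auto simp: H_def intro: subpartition_subset)
    \<comment> \<open>Optimality of \<open>\<X>'\<close> bounds the traces by
      \<open>excess G X'\<close>, which is exactly what merging \<open>X'\<close> with the blocks of
      \<open>H\<close> has to pay.\<close>
    have le: "(\<Sum>X\<in>H. excess G (X \<inter> X')) \<le> excess G X'"
      by (rule optimal_split[OF assms(1) *(1,2) H(1)]) (simp add: H_def)
    note ex = subpartition_hits_exchange[OF sub X', folded H_def]
    have "optimal T ((\<X> - H) \<union> {X' \<union> \<Union>H})"
      using ex le opt assms(1) unfolding optimal_def bounded_def by (smt (verit))
    moreover have "excess G (X' \<union> \<Union>H) \<ge> 1"
    proof -
      have "excess G X' + sum (excess G) H
          \<le> excess G (X' \<union> \<Union>H) + (\<Sum>X\<in>H. excess G (X \<inter> X'))"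
        using H X' fin_subpartition[OF H(1)]
        by (intro excess_Union_hits) (auto simp: subpartition_def)
      moreover have "sum (excess G) H \<ge> excess G X"
        using H fin_subpartition[OF H(1)] pos by (intro member_le_sum) force+
      ultimately show ?thesis using le pos[OF *(3)] by linarith
    qed
    ultimately have "X' \<union> \<Union>H \<subseteq> X"
      using pos H by (intro absorb[of H "X' \<union> \<Union>H" X]) auto
    then show "X' \<subseteq> X" by blast
  qed
  then show ?thesis by (rule that)
qed

text \<open>The candidates for endpoints of the new edge. If \<open>T\<close> is not attained, every
  vertex of \<open>A\<close> qualifies.\<close>

definition essential :: "int \<Rightarrow> 'v \<Rightarrow> bool" where
  "essential T x \<longleftrightarrow> x \<in> A \<and> (\<forall>\<X>. optimal T \<X> \<longrightarrow> x \<in> \<Union>\<X>)"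

text \<open>Any vertex of a minimal bad set inside \<open>X\<close> will do, since every optimal
  family has a block containing that set.\<close>

lemma essential_exists:
  assumes "bounded T" "X \<subseteq> A" "X \<noteq> {}" "excess G X \<ge> 1"
  obtains x where "x \<in> X" "essential T x"
proof -
  obtain S where S: "S \<subseteq> X" "min_bad S" using min_bad_exists assms by blast
  then obtain x where x: "x \<in> S" unfolding min_bad_def by blast
  have "x \<in> \<Union>\<X>" if "optimal T \<X>" for \<X>
    using min_bad_in_optimal[OF assms(1) that S(2)] x by blast
  then have "essential T x" using x S assms unfolding essential_def by blast
  then show ?thesis using that x S by blast
qed

lemma optimal_block:
  assumes "optimal T \<X>" "X \<in> \<X>"
  shows "X \<subseteq> A" "X \<noteq> {}"
  using assms unfolding optimal_def subpartition_def by auto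

lemma coarsest_representatives:
  assumes "bounded T" "coarsest T \<X>"
  obtains x where "\<And>X. X \<in> \<X> \<Longrightarrow> x X \<in> X" "\<And>X. X \<in> \<X> \<Longrightarrow> essential T (x X)"
proof -
  have "\<forall>X\<in>\<X>. \<exists>x. x \<in> X \<and> essential T x"
  proof
    fix X assume X: "X \<in> \<X>"
    have "optimal T \<X>" "excess G X \<ge> 1" using assms(2) X by (simp_all add: coarsest_def)
    moreover note optimal_block[OF this(1) X]
    ultimately
    show "\<exists>x. x \<in> X \<and> essential T x" using essential_exists[OF assms(1)] by blast
  qed
  from bchoice[OF this] show ?thesis using that by blast
qed

text \<open>The optimal family covers \<open>u\<close> by essentiality; the covering block meets
  \<open>X\<close>, hence lies inside \<open>X\<close> and misses \<open>v\<close> as a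
  neighbour.\<close>

lemma coarsest_hit:
  assumes "coarsest T \<X>" "X \<in> \<X>" "u \<in> X" "essential T u" "v \<notin> nbhd G X" "optimal T \<Z>"
  shows "\<exists>Z\<in>\<Z>. u \<in> Z \<and> v \<notin> nbhd G Z"
proof -
  obtain Z where Z: "Z \<in> \<Z>" "u \<in> Z" using assms unfolding essential_def by blast
  then have "Z \<subseteq> X" using coarsestD(4)[OF assms(1,2,6)] assms(3) by blast
  then have "v \<notin> nbhd G Z" using assms(5) nbhd_mono by blast
  then show ?thesis using Z by blast
qed

lemma coarsest_nonempty: "coarsest T \<X> \<Longrightarrow> T \<ge> 2 \<Longrightarrow> \<X> \<noteq> {}"
  unfolding coarsest_def optimal_def by (auto simp: tau_def)

text \<open>Two blocks have disjoint neighbourhoods, so \<open>v\<close> is missing from one of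
  them.\<close>

lemma coarsest_avoid:
  assumes "coarsest T \<X>" "X \<in> \<X>" "\<X> \<noteq> {X}"
  obtains Y where "Y \<in> \<X>" "v \<notin> nbhd G Y"
proof -
  obtain Y where Y: "Y \<in> \<X>" "Y \<noteq> X" using assms(2,3) by blast
  then have "nbhd G X \<inter> nbhd G Y = {}" using coarsestD(3)[OF assms(1,2)] by blast
  then show ?thesis using that assms(2) Y by blast
qed

section \<open>Choosing the new edge\<close>

text \<open>With no condition from the other side, any \<open>v\<close> outside the neighbourhood of
  some block of the coarsest family can be joined to an essential vertex of that block.\<close>

lemma one_sided_edge:
  assumes "T \<ge> 2" "bounded T" "optimal T \<X>\<^sub>0"
  obtains u v where "u \<in> A" "v \<in> B" "\<And>\<Z>. optimal T \<Z> \<Longrightarrow> \<exists>Z\<in>\<Z>. u \<in> Z \<and> v \<notin> nbhd G Z"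
proof -
  obtain \<X> where \<X>: "coarsest T \<X>" using coarsest_exists[OF assms(2,3)] .
  obtain x where x: "\<And>X. X \<in> \<X> \<Longrightarrow> x X \<in> X" "\<And>X. X \<in> \<X> \<Longrightarrow> essential T (x X)"
    using coarsest_representatives[OF assms(2) \<X>] by blast
  have opt: "optimal T \<X>" using \<X> by (simp add: coarsest_def)
  obtain X where X: "X \<in> \<X>" using coarsest_nonempty[OF \<X> assms(1)] by blast
  note XA = optimal_block[OF opt X]
  obtain Y v where "Y \<in> \<X>" "v \<in> B" "v \<notin> nbhd G Y"
  proof (cases "\<X> = {X}")
    case True
    \<comment> \<open>Here \<open>|nbhd G X| = |X| + 1 - T\<close>, which is below
      \<open>|B|\<close> because \<open>T\<close> is at least 2.\<close>
    then have "excess G X = T" using opt by (simp add: optimal_def tau_single)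
    moreover have "card X \<le> card B" using card_mono[OF fin(1) XA(1)] card_eq by simp
    ultimately have "card (nbhd G X) < card B" using assms(1) unfolding excess_def by linarith
    then have "\<not> B \<subseteq> nbhd G X" using card_mono[OF fin_nbhd[OF XA(1)]] by (metis not_le)
    then show ?thesis using that X by blast
  next
    case False
    have "B \<noteq> {}" using XA fin card_eq by (metis card_eq_0_iff subset_empty)
    then obtain b where "b \<in> B" by blast
    then show ?thesis using that coarsest_avoid[OF \<X> X False, of b] by blast
  qed
  then show ?thesis
    using that[of "x Y" v] coarsest_hit[OF \<X>, of Y "x Y" v] x optimal_block[OF opt] by blast
qed

text \<open>The complement has at least the excess of \<open>X\<close>, and the bound on the other
  side turns this into equality. The cardinality hypothesis makes it nonempty, hence a legitimate
  block.\<close>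

lemma complement_optimal:
  assumes "T \<ge> 1" "balanced_bipartite.bounded G B T" "optimal T {X}" "card (nbhd G X) < card B"
  shows "balanced_bipartite.optimal G B T {B - nbhd G X}"
proof -
  interpret fl: balanced_bipartite G B A by (rule flip)
  have X: "X \<subseteq> A" using optimal_block[OF assms(3)] by blast
  have "B - nbhd G X \<noteq> {}" using assms(4) card_mono[OF fin_nbhd[OF X]] by (metis Diff_eq_empty_iff not_le)
  then have sub: "subpartition B {B - nbhd G X}" by (intro subpartition_single) auto
  moreover have "excess G (B - nbhd G X) \<ge> T"
    using excess_complement[OF X] assms(3) by (simp add: optimal_def tau_single)
  ultimately show ?thesis
    using assms(2) unfolding fl.optimal_def fl.bounded_def by (auto simp: tau_single intro: antisym)
qed

text \<open>The complement of the neighbourhood alone is an optimal family on the other side, so it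
  contains every essential vertex there.\<close>

lemma single_block_complement:
  assumes "T \<ge> 2" "balanced_bipartite.bounded G B T" "optimal T {X}"
    and "balanced_bipartite.essential G B T y"
  shows "y \<notin> nbhd G X"
proof -
  interpret fl: balanced_bipartite G B A by (rule flip)
  have X: "X \<subseteq> A" using optimal_block[OF assms(3)] by blast
  have "excess G X = T" using assms by (simp add: optimal_def tau_single)
  moreover have "card X \<le> card B" using card_mono[OF fin(1) X] card_eq by simp
  ultimately have "card (nbhd G X) < card B" using assms(1) unfolding excess_def by linarith
  then have "fl.optimal T {B - nbhd G X}" using complement_optimal assms by simp
  then show ?thesis using assms(4) unfolding fl.essential_def by blast
qed

text \<open>Each block of the two coarsest families gets an essential representative. It suffices to
  find a pair of blocks in which neither representative is adjacent to the opposite block;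
  \<open>coarsest_hit\<close> then applies on both sides.\<close>

lemma two_sided_edge:
  assumes "T \<ge> 2" "bounded T" "optimal T \<X>\<^sub>0"
    and "balanced_bipartite.bounded G B T" "balanced_bipartite.optimal G B T \<Y>\<^sub>0"
  obtains u v where "u \<in> A" "v \<in> B" "\<And>\<Z>. optimal T \<Z> \<Longrightarrow> \<exists>Z\<in>\<Z>. u \<in> Z \<and> v \<notin> nbhd G Z"
    "\<And>\<Z>. balanced_bipartite.optimal G B T \<Z> \<Longrightarrow> \<exists>Z\<in>\<Z>. v \<in> Z \<and> u \<notin> nbhd G Z"
proof -
  interpret fl: balanced_bipartite G B A by (rule flip)
  obtain \<X> where \<X>: "coarsest T \<X>" using coarsest_exists[OF assms(2,3)] .
  obtain \<Y> where \<Y>: "fl.coarsest T \<Y>" using fl.coarsest_exists[OF assms(4,5)] .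
  obtain x where x: "\<And>X. X \<in> \<X> \<Longrightarrow> x X \<in> X" "\<And>X. X \<in> \<X> \<Longrightarrow> essential T (x X)"
    using coarsest_representatives[OF assms(2) \<X>] by blast
  obtain y where y: "\<And>Y. Y \<in> \<Y> \<Longrightarrow> y Y \<in> Y" "\<And>Y. Y \<in> \<Y> \<Longrightarrow> fl.essential T (y Y)"
    using fl.coarsest_representatives[OF assms(4) \<Y>] by blast
  have optX: "optimal T \<X>" using \<X> by (simp add: coarsest_def)
  have optY: "fl.optimal T \<Y>" using \<Y> by (simp add: fl.coarsest_def)
  obtain X where X: "X \<in> \<X>" using coarsest_nonempty[OF \<X> assms(1)] by blast
  obtain Y where Y: "Y \<in> \<Y>" using fl.coarsest_nonempty[OF \<Y> assms(1)] by blast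
  have single_X: "y Y' \<notin> nbhd G X'" if "\<X> = {X'}" "Y' \<in> \<Y>" for X' Y'
    using single_block_complement[OF assms(1,4)] optX y(2) that by blast
  have single_Y: "x X' \<notin> nbhd G Y'" if "\<Y> = {Y'}" "X' \<in> \<X>" for X' Y'
    using fl.single_block_complement[OF assms(1,2)] optY x(2) that by blast
  have "\<exists>X\<in>\<X>. \<exists>Y\<in>\<Y>. y Y \<notin> nbhd G X \<and> x X \<notin> nbhd G Y"
  proof (cases "\<X> = {X} \<or> \<Y> = {Y}")
    case True
    \<comment> \<open>A one-block family settles one of the two conditions for every pair. The other
      holds likewise if the second family has one block, and by choosing a block that avoids the
      representative if it has several.\<close>
    then show ?thesis
      using X Y single_X single_Y coarsest_avoid[OF \<X> X, of "y Y"]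
        fl.coarsest_avoid[OF \<Y> Y, of "x X"] by metis
  next
    case False
    show ?thesis
    proof (rule ccontr)
      txt \<open>Following the bad pairs around leads to blocks \<open>X\<close>, \<open>Y2\<close> that uncross to an optimal
        family avoiding the essential vertex \<open>x X\<close>.\<close>
      assume "\<not> ?thesis"
      then have bad: "y Y \<in> nbhd G X \<or> x X \<in> nbhd G Y" if "X \<in> \<X>" "Y \<in> \<Y>" for X Y
        using that by blast
      have disX: "nbhd G X1 \<inter> nbhd G X2 = {}" if "X1 \<in> \<X>" "X2 \<in> \<X>" "X1 \<noteq> X2" for X1 X2
        using coarsestD(3)[OF \<X> that(1)] that(2,3) by blast
      have disY: "nbhd G Y1 \<inter> nbhd G Y2 = {}" if "Y1 \<in> \<Y>" "Y2 \<in> \<Y>" "Y1 \<noteq> Y2" for Y1 Y2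
        using fl.coarsestD(3)[OF \<Y> that(1)] that(2,3) by blast
      obtain Y1 where Y1: "Y1 \<in> \<Y>" "x X \<notin> nbhd G Y1"
        using fl.coarsest_avoid[OF \<Y> Y, of "x X"] False by blast
      then have 1: "y Y1 \<in> nbhd G X" using bad X by blast
      obtain X2 where X2: "X2 \<in> \<X>" "X2 \<noteq> X" using False X by blast
      then have 2: "x X2 \<in> nbhd G Y1" using bad[OF X2(1) Y1(1)] 1 disX[OF X X2(1)] by blast
      obtain Y2 where Y2: "Y2 \<in> \<Y>" "Y2 \<noteq> Y1" using False Y1 Y by blast
      then have 3: "y Y2 \<in> nbhd G X2" using bad[OF X2(1) Y2(1)] 2 disY[OF Y1(1) Y2(1)] by blast
      then have 4: "x X \<in> nbhd G Y2" using bad[OF X Y2(1)] disX[OF X X2(1)] X2(2) by blast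
      \<comment> \<open>Both differences must be nonempty to serve as blocks: \<open>z\<close> lies
        in \<open>nbhd G Y1\<close>, hence outside \<open>nbhd G Y2\<close>, and \<open>y Y2\<close>
        lies in \<open>nbhd G X2\<close>, hence outside \<open>nbhd G X\<close>.\<close>
      obtain z where z: "z \<in> X" "y Y1 \<in> nbhd G {z}" using 1 nbhd_iff[of "y Y1" G X] by blast
      then have "z \<in> nbhd G Y1"
        using nbhd_sym[of z G "y Y1"] nbhd_iff[of z G Y1] y(1)[OF Y1(1)] by blast
      then have ne1: "X - nbhd G Y2 \<noteq> {}" using z disY[OF Y1(1) Y2(1)] Y2(2) by blast
      have ne2: "Y2 - nbhd G X \<noteq> {}" using 3 y(1)[OF Y2(1)] disX[OF X X2(1)] X2(2) by blast
      have "excess G X + excess G Y2 \<le> excess G (X - nbhd G Y2) + excess G (Y2 - nbhd G X)"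
        using excess_cross optimal_block[OF optX X] fl.optimal_block[OF optY Y2(1)] by blast
      moreover have "excess G (Y2 - nbhd G X) \<le> excess G Y2"
        using fl.optimal_replace(1)[OF assms(4) optY Y2(1) _ ne2] by blast
      moreover have "excess G (X - nbhd G Y2) \<le> excess G X"
        using optimal_replace(1)[OF assms(2) optX X _ ne1] by blast
      \<comment> \<open>Neither term can grow, so the cross inequality is tight. The shrunken family
        is therefore optimal although the removed part contains \<open>x X\<close>.\<close>
      ultimately have "excess G (X - nbhd G Y2) = excess G X" by linarith
      then have "optimal T ((\<X> - {X}) \<union> {X - nbhd G Y2})"
        using optimal_replace(2)[OF assms(2) optX X _ ne1] by blast
      then have "x X \<in> \<Union>((\<X> - {X}) \<union> {X - nbhd G Y2})"
        using x(2)[OF X] unfolding essential_def by blast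
      then obtain X3 where "X3 \<in> \<X>" "X3 \<noteq> X" "x X \<in> X3" using 4 by blast
      then show False
        using x(1)[OF X] X optX subpartition_disjoint[of A \<X> X X3] unfolding optimal_def by blast
    qed
  qed
  then obtain X Y where XY: "X \<in> \<X>" "Y \<in> \<Y>" "y Y \<notin> nbhd G X" "x X \<notin> nbhd G Y" by blast
  show ?thesis
  proof (rule that[of "x X" "y Y"])
    show "x X \<in> A" using x(1)[OF XY(1)] optimal_block[OF optX XY(1)] by blast
    show "y Y \<in> B" using y(1)[OF XY(2)] fl.optimal_block[OF optY XY(2)] by blast
    show "\<exists>Z\<in>\<Z>. x X \<in> Z \<and> y Y \<notin> nbhd G Z" if "optimal T \<Z>" for \<Z>
      using coarsest_hit[OF \<X> XY(1) x(1)[OF XY(1)] x(2)[OF XY(1)] XY(3) that] .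
    show "\<exists>Z\<in>\<Z>. y Y \<in> Z \<and> x X \<notin> nbhd G Z" if "fl.optimal T \<Z>" for \<Z>
      using fl.coarsest_hit[OF \<Y> XY(2) y(1)[OF XY(2)] y(2)[OF XY(2)] XY(4) that] .
  qed
qed

text \<open>On a side where \<open>T\<close> is not attained the requirement is vacuous, which
  reduces the claim to the two previous constructions or to an arbitrary pair.\<close>

lemma improving_edge:
  assumes "T \<ge> 2" "A \<noteq> {}" "bounded T" "balanced_bipartite.bounded G B T"
  obtains u v where "u \<in> A" "v \<in> B" "\<And>\<Z>. optimal T \<Z> \<Longrightarrow> \<exists>Z\<in>\<Z>. u \<in> Z \<and> v \<notin> nbhd G Z"
    "\<And>\<Z>. balanced_bipartite.optimal G B T \<Z> \<Longrightarrow> \<exists>Z\<in>\<Z>. v \<in> Z \<and> u \<notin> nbhd G Z"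
proof -
  interpret fl: balanced_bipartite G B A by (rule flip)
  consider (both) \<X> \<Y> where "optimal T \<X>" "fl.optimal T \<Y>"
    | (left) \<X> where "optimal T \<X>" "\<nexists>\<Y>. fl.optimal T \<Y>"
    | (right) \<Y> where "fl.optimal T \<Y>" "\<nexists>\<X>. optimal T \<X>"
    | (none) "\<nexists>\<X>. optimal T \<X>" "\<nexists>\<Y>. fl.optimal T \<Y>" by blast
  then show ?thesis
  proof cases
    case both
    show ?thesis by (rule two_sided_edge[OF assms(1,3) both(1) assms(4) both(2)]) (rule that)
  next
    case left
    obtain u v where uv: "u \<in> A" "v \<in> B"
      "\<And>\<Z>. optimal T \<Z> \<Longrightarrow> \<exists>Z\<in>\<Z>. u \<in> Z \<and> v \<notin> nbhd G Z"
      using one_sided_edge[OF assms(1,3) left(1)] by blast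
    show ?thesis using left(2) by (intro that[OF uv]) auto
  next
    case right
    obtain v u where vu: "v \<in> B" "u \<in> A"
      "\<And>\<Z>. fl.optimal T \<Z> \<Longrightarrow> \<exists>Z\<in>\<Z>. v \<in> Z \<and> u \<notin> nbhd G Z"
      using fl.one_sided_edge[OF assms(1,4) right(1)] by blast
    show ?thesis using right(2) by (intro that[OF vu(2,1) _ vu(3)]) auto
  next
    case none
    have "B \<noteq> {}" using assms(2) fin card_eq by (metis card_eq_0_iff)
    then obtain u v where uv: "u \<in> A" "v \<in> B" using assms(2) by blast
    show ?thesis using none by (intro that[OF uv]) auto
  qed
qed

section \<open>Adding edges\<close>

lemma add_edges_balanced:
  assumes "F \<subseteq> plus_side G \<times> minus_side G"
  shows "balanced_bipartite (add_edges G F) A B"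
  using bip sides card_eq assms by unfold_locales (auto simp: add_edges_def bipartite_graph_def)

text \<open>Both orientations of the pair occur, because edges are stored from plus to minus while
  \<open>A\<close> may be either side.\<close>

lemma nbhd_add_edge:
  assumes "u \<in> A" "v \<in> B" "X \<subseteq> A" "F = {(u, v)} \<or> F = {(v, u)}"
  shows "nbhd (add_edges G F) X = nbhd G X \<union> (if u \<in> X then {v} else {})"
  using assms sides_disjoint by (auto simp: nbhd_def add_edges_def)

lemma excess_add_edge:
  assumes "u \<in> A" "v \<in> B" "X \<subseteq> A" "F = {(u, v)} \<or> F = {(v, u)}"
  shows "excess (add_edges G F) X
    = excess G X - (if u \<in> X \<and> v \<notin> nbhd G X then 1 else 0)"
  unfolding excess_def nbhd_add_edge[OF assms] using fin_nbhd[OF assms(3)]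
  by (auto simp: insert_absorb)

text \<open>No excess increases, and by \<open>hit\<close> each family of value \<open>T\<close> has
  a block whose excess drops. Values are integers, so all end up at most
  \<open>T - 1\<close>.\<close>

lemma bounded_add_edge:
  assumes "bounded T" "u \<in> A" "v \<in> B" and F: "F = {(u, v)} \<or> F = {(v, u)}"
    and "F \<subseteq> plus_side G \<times> minus_side G"
    and hit: "\<And>\<Z>. optimal T \<Z> \<Longrightarrow> \<exists>Z\<in>\<Z>. u \<in> Z \<and> v \<notin> nbhd G Z"
  shows "balanced_bipartite.bounded (add_edges G F) A (T - 1)"
proof -
  let ?G = "add_edges G F"
  interpret G': balanced_bipartite ?G A B using assms(5) by (rule add_edges_balanced)
  have "tau ?G \<Z> \<le> T - 1" if \<Z>: "subpartition A \<Z>" for \<Z>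
  proof -
    have le: "excess ?G Z \<le> excess G Z" if "Z \<in> \<Z>" for Z
      using excess_add_edge[OF assms(2,3) _ F, of Z] that \<Z> unfolding subpartition_def by auto
    show ?thesis
    proof (cases "optimal T \<Z>")
      case True
      then obtain Z where Z: "Z \<in> \<Z>" "u \<in> Z" "v \<notin> nbhd G Z" using hit by blast
      have "excess ?G Z < excess G Z"
        using excess_add_edge[OF assms(2,3) _ F, of Z] Z \<Z> unfolding subpartition_def by auto
      then have "tau ?G \<Z> < tau G \<Z>" unfolding tau_eq_sum_excess
        using le Z(1) fin_subpartition[OF \<Z>] by (intro sum_strict_mono_ex1) auto
      then show ?thesis using True unfolding optimal_def by simp
    next
      case False
      then have "tau G \<Z> < T" using \<Z> assms(1) unfolding bounded_def optimal_def
        by (simp add: order.not_eq_order_implies_strict)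
      moreover have "tau ?G \<Z> \<le> tau G \<Z>" unfolding tau_eq_sum_excess using le by (rule sum_mono)
      ultimately show ?thesis by simp
    qed
  qed
  then show ?thesis unfolding G'.bounded_def by blast
qed

section \<open>Irreducibility and its two sides\<close>

lemma excess_side_ge: "excess G A \<ge> 1"
  using excess_le[of A B] nbhd_subset[of A] card_eq by simp

text \<open>The strict Hall condition \<open>|nbhd G X| > |X|\<close>. The whole side is left out,
  since its excess is always at least 1.\<close>

definition irreducible :: bool where
  "irreducible \<longleftrightarrow> (\<forall>X. X \<subset> A \<longrightarrow> X \<noteq> {} \<longrightarrow> excess G X \<le> 0)"

lemma irreducibleD: "irreducible \<Longrightarrow> X \<subset> A \<Longrightarrow> X \<noteq> {} \<Longrightarrow> excess G X \<le> 0"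
  by (simp add: irreducible_def)

text \<open>If a proper \<open>X\<close> has excess 1, then \<open>{X}\<close> and
  \<open>{B - nbhd G X}\<close> are optimal for the bound 1. Essential vertices \<open>u\<close> and
  \<open>v\<close> therefore satisfy \<open>u \<in> X\<close> and
  \<open>v \<notin> nbhd G X\<close>, and the edge between them lowers the excess of every such
  \<open>X\<close> to 0.\<close>

lemma irreducible_add_edge:
  assumes "A \<noteq> {}" "bounded 1" "balanced_bipartite.bounded G B 1"
  obtains u v where "u \<in> A" "v \<in> B"
    "\<And>F. F = {(u, v)} \<or> F = {(v, u)} \<Longrightarrow> F \<subseteq> plus_side G \<times> minus_side G
       \<Longrightarrow> balanced_bipartite.irreducible (add_edges G F) A"
proof -
  interpret fl: balanced_bipartite G B A by (rule flip)
  obtain u where u: "u \<in> A" "essential 1 u"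
    using essential_exists[OF assms(2) _ assms(1) excess_side_ge] by blast
  have "B \<noteq> {}" using assms(1) fin card_eq by (metis card_eq_0_iff)
  then obtain v where v: "v \<in> B" "fl.essential 1 v"
    using fl.essential_exists[OF assms(3) _ _ fl.excess_side_ge] by blast
  have "balanced_bipartite.irreducible (add_edges G F) A"
    if F: "F = {(u, v)} \<or> F = {(v, u)}" and FG: "F \<subseteq> plus_side G \<times> minus_side G" for F
  proof -
    interpret G': balanced_bipartite "add_edges G F" A B by (rule add_edges_balanced[OF FG])
    have "excess (add_edges G F) X \<le> 0" if X: "X \<subset> A" "X \<noteq> {}" for X
    proof -
      have XA: "X \<subseteq> A" using X by blast
      have sub: "subpartition A {X}" using X by (intro subpartition_single) auto
      then have le: "excess G X \<le> 1" using assms(2) unfolding bounded_def by (metis tau_single)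
      show ?thesis
      proof (cases "excess G X = 1")
        case True
        then have opt: "optimal 1 {X}" using sub by (simp add: optimal_def tau_single)
        then have "u \<in> X" using u(2) unfolding essential_def by blast
        moreover have "card (nbhd G X) < card B"
          using True psubset_card_mono[OF fin(1) X(1)] card_eq unfolding excess_def by simp
        then have "fl.optimal 1 {B - nbhd G X}"
          using complement_optimal[OF _ assms(3) opt] by simp
        then have "v \<notin> nbhd G X" using v(2) unfolding fl.essential_def by blast
        ultimately show ?thesis using excess_add_edge[OF u(1) v(1) XA F] True by simp
      next
        case False
        then show ?thesis using excess_add_edge[OF u(1) v(1) XA F] le by simp
      qed
    qed
    then show ?thesis unfolding G'.irreducible_def by blast
  qed
  then show ?thesis using that u v by blast
qed

text \<open>For a violating \<open>Y\<close>, the set \<open>A - nbhd G Y\<close> has excess at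
  least 1 and is nonempty, so it must be all of \<open>A\<close> and \<open>Y\<close> has no
  neighbours. Then \<open>A\<close> minus one vertex violates irreducibility; it is nonempty because
  \<open>A\<close> has two vertices.\<close>

lemma irreducible_flip:
  assumes "card A \<ge> 2" "irreducible"
  shows "balanced_bipartite.irreducible G B"
proof -
  interpret fl: balanced_bipartite G B A by (rule flip)
  have "excess G Y \<le> 0" if Y: "Y \<subset> B" "Y \<noteq> {}" for Y
  proof (rule ccontr)
    assume ex: "\<not> excess G Y \<le> 0"
    define X where "X = A - nbhd G Y"
    have "excess G X \<ge> 1" using fl.excess_complement[of Y] Y ex unfolding X_def by auto
    moreover have "X \<noteq> {}"
    proof
      assume "X = {}"
      then have "card A \<le> card (nbhd G Y)"
        using card_mono[OF fl.fin_nbhd[of Y], of A] Y unfolding X_def by auto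
      then show False using ex psubset_card_mono[OF fin(2) Y(1)] card_eq unfolding excess_def by simp
    qed
    ultimately have "\<not> X \<subset> A" using irreducibleD[OF assms(2), of X] by auto
    then have N: "nbhd G A \<subseteq> B - Y"
      using nbhd_Diff_nbhd[of G A Y] nbhd_subset[of A] unfolding X_def by auto
    obtain a where a: "a \<in> A" using assms(1) by fastforce
    have "nbhd G (A - {a}) \<subseteq> B - Y" using N nbhd_mono[of "A - {a}" A G] by blast
    then have "int (card (A - {a})) - int (card (B - Y)) + 1 \<le> excess G (A - {a})"
      by (intro excess_le) auto
    moreover have "card (B - Y) < card B" using Y fin by (intro psubset_card_mono) auto
    moreover have "card (A - {a}) = card A - 1" using a fin by simp
    ultimately have "excess G (A - {a}) \<ge> 1" using card_eq assms(1) by linarith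
    moreover have "A - {a} \<noteq> {}" using assms(1) \<open>card (A - {a}) = card A - 1\<close>
      by (metis One_nat_def Suc_1 card.empty diff_is_0_eq not_less_eq_eq)
    moreover have "A - {a} \<subset> A" using a by blast
    ultimately show False using irreducibleD[OF assms(2), of "A - {a}"] by auto
  qed
  then show ?thesis unfolding fl.irreducible_def by blast
qed

text \<open>Each block must gain at least \<open>excess G X\<close> new neighbours, hence as many
  edges of \<open>F\<close>. Disjoint blocks on one side use disjoint sets of edges.\<close>

lemma tau_le_card:
  assumes F: "F \<subseteq> plus_side G \<times> minus_side G"
    and irr: "balanced_bipartite.irreducible (add_edges G F) A"
    and \<X>: "proper_subpartition A \<X>"
  shows "tau G \<X> \<le> int (card F)"
proof -
  interpret G': balanced_bipartite "add_edges G F" A B by (rule add_edges_balanced[OF F])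
  define E where "E X = {e \<in> F. fst e \<in> X \<or> snd e \<in> X}" for X
  have sub: "subpartition A \<X>" using \<X> by (simp add: proper_subpartition_def)
  have finF: "finite F"
    using F bip finite_subset[of F "plus_side G \<times> minus_side G"] by (auto simp: bipartite_graph_def)
  then have finE: "finite (E X)" for X by (simp add: E_def)
  have "excess G X \<le> int (card (E X))" if X: "X \<in> \<X>" for X
  proof -
    have XA: "X \<subseteq> A" "X \<noteq> {}" using X sub unfolding subpartition_def by auto
    \<comment> \<open>A block equal to \<open>A\<close> leaves no room for another one, so the
      family would be \<open>{A}\<close>, which properness excludes.\<close>
    have "X \<noteq> A"
    proof
      assume "X = A"
      have "Y = X" if "Y \<in> \<X>" for Y
      proof (rule ccontr)
        assume "Y \<noteq> X"
        then have "X \<inter> Y = {}" using subpartition_disjoint[OF sub X that] by blast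
        moreover have "Y \<subseteq> A" "Y \<noteq> {}" using sub that unfolding subpartition_def by auto
        ultimately show False using \<open>X = A\<close> by blast
      qed
      then have "\<X> = {A}" using X \<open>X = A\<close> by blast
      then show False using \<X> by (simp add: proper_subpartition_def)
    qed
    then have le0: "excess (add_edges G F) X \<le> 0" using G'.irreducibleD[OF irr, of X] XA by blast
    \<comment> \<open>The map sends an edge to its endpoint in \<open>B\<close>, whichever
      coordinate that is.\<close>
    have "nbhd (add_edges G F) X
        \<subseteq> nbhd G X \<union> (\<lambda>e. if fst e \<in> A then snd e else fst e) ` E X"
    proof
      fix w assume "w \<in> nbhd (add_edges G F) X"
      then obtain z where z: "z \<in> X" "(z, w) \<in> edges G \<union> F \<or> (w, z) \<in> edges G \<union> F"
        unfolding nbhd_def add_edges_def by auto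
      consider "(z, w) \<in> edges G \<or> (w, z) \<in> edges G" | "(z, w) \<in> F" | "(w, z) \<in> F"
        using z by blast
      then show "w \<in> nbhd G X \<union> (\<lambda>e. if fst e \<in> A then snd e else fst e) ` E X"
      proof cases
        case 1
        then show ?thesis using z(1) unfolding nbhd_def by auto
      next
        case 2
        then have "(z, w) \<in> E X" "z \<in> A" using z(1) XA by (auto simp: E_def)
        then show ?thesis by force
      next
        case 3
        then have "(w, z) \<in> E X" "w \<notin> A"
          using z(1) XA F sides sides_disjoint by (auto simp: E_def)
        then show ?thesis by force
      qed
    qed
    then have "card (nbhd (add_edges G F) X)
        \<le> card (nbhd G X \<union> (\<lambda>e. if fst e \<in> A then snd e else fst e) ` E X)"
      using fin_nbhd[OF XA(1)] finE by (intro card_mono) auto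
    also have "\<dots> \<le> card (nbhd G X) + card (E X)"
      by (meson add_left_mono card_Un_le card_image_le finE le_trans)
    finally show ?thesis using le0 unfolding excess_def by linarith
  qed
  then have "tau G \<X> \<le> (\<Sum>X\<in>\<X>. int (card (E X)))" unfolding tau_eq_sum_excess by (rule sum_mono)
  also have "\<dots> = int (\<Sum>X\<in>\<X>. card (E X))" by simp
  also have "(\<Sum>X\<in>\<X>. card (E X)) = card (\<Union>X\<in>\<X>. E X)"
  proof (rule card_UN_disjoint[symmetric])
    show "\<forall>X\<in>\<X>. \<forall>Y\<in>\<X>. X \<noteq> Y \<longrightarrow> E X \<inter> E Y = {}"
    proof (intro ballI impI)
      fix X Y assume XY: "X \<in> \<X>" "Y \<in> \<X>" "X \<noteq> Y"
      then have "X \<subseteq> A" "Y \<subseteq> A" "X \<inter> Y = {}"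
        using sub subpartition_disjoint[OF sub XY] unfolding subpartition_def by simp_all blast+
      moreover have "F \<subseteq> A \<times> B \<or> F \<subseteq> B \<times> A" using F sides by blast
      ultimately show "E X \<inter> E Y = {}" using sides_disjoint unfolding E_def by auto blast+
    qed
  qed (use fin_subpartition[OF sub] finE in auto)
  also have "card (\<Union>X\<in>\<X>. E X) \<le> card F" by (intro card_mono finF) (auto simp: E_def)
  finally show ?thesis by simp
qed

text \<open>Shows that admitting the improper family \<open>{A}\<close> does not raise the maximum.
  Its value is \<open>|I| + 1\<close> for the isolated vertices \<open>I\<close> of
  \<open>B\<close>, whose singletons have value \<open>2 * |I|\<close>; the case of empty
  \<open>I\<close> is covered by \<open>M \<ge> 1\<close>.\<close>

lemma excess_side_le:
  assumes "card A \<ge> 2" "M \<ge> 1" "\<And>\<Y>. proper_subpartition B \<Y> \<Longrightarrow> tau G \<Y> \<le> M"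
  shows "excess G A \<le> M"
proof -
  interpret fl: balanced_bipartite G B A by (rule flip)
  define I where "I = B - nbhd G A"
  have I: "card I = card B - card (nbhd G A)" "card (nbhd G A) \<le> card B" "finite I"
    using nbhd_subset[of A] fin fin_nbhd[of A]
    by (auto simp: I_def card_Diff_subset card_mono)
  have nb: "nbhd G {v} = {}" if "v \<in> I" for v
  proof (rule ccontr)
    assume "nbhd G {v} \<noteq> {}"
    then obtain w where w: "w \<in> nbhd G {v}" by blast
    then have "w \<in> A" using fl.nbhd_subset[of "{v}"] that by (auto simp: I_def)
    then have "v \<in> nbhd G A" using w nbhd_sym[of w G v] nbhd_iff[of v G A] by blast
    then show False using that by (simp add: I_def)
  qed
  txt \<open>Each vertex isolated in \<open>B\<close> contributes 2 as a singleton, but only 1 to \<open>excess G A\<close>.\<close>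
  let ?Y = "(\<lambda>v. {v}) ` I"
  have "tau G ?Y = (\<Sum>v\<in>I. excess G {v})"
    unfolding tau_eq_sum_excess by (simp add: sum.reindex)
  also have "\<dots> = (\<Sum>v\<in>I. 2)" by (rule sum.cong) (auto simp: excess_def nb)
  finally have "tau G ?Y = 2 * int (card I)" by simp
  moreover have "proper_subpartition B ?Y"
  proof -
    have "?Y \<noteq> {B}"
    proof
      assume "?Y = {B}"
      then obtain v where "B = {v}" by blast
      then show False using assms(1) card_eq by simp
    qed
    moreover have "subpartition B ?Y"
      unfolding subpartition_def by (auto simp: I_def intro: disjointI)
    ultimately show ?thesis by (simp add: proper_subpartition_def)
  qed
  ultimately have "2 * int (card I) \<le> M" using assms(3) by metis
  then show ?thesis using I assms(2) card_eq unfolding excess_def by linarith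
qed

end

text \<open>Each improving edge lowers the common bound by 1. The induction is anchored at the bound
  1, where a single edge yields irreducibility.\<close>

lemma irreducible_augmentation:
  assumes "balanced_bipartite G P M" "P = plus_side G" "M = minus_side G" "P \<noteq> {}"
    and "balanced_bipartite.bounded G P (int (Suc k))" "balanced_bipartite.bounded G M (int (Suc k))"
  shows "\<exists>F. F \<subseteq> P \<times> M - edges G \<and> card F \<le> Suc k
           \<and> balanced_bipartite.irreducible (add_edges G F) P"
  using assms
proof (induction k arbitrary: G)
  case 0
  interpret balanced_bipartite G P M by fact
  obtain u v where uv: "u \<in> P" "v \<in> M"
    "\<And>F. F = {(u, v)} \<or> F = {(v, u)} \<Longrightarrow> F \<subseteq> plus_side G \<times> minus_side G
       \<Longrightarrow> balanced_bipartite.irreducible (add_edges G F) P"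
    using irreducible_add_edge 0 by auto
  \<comment> \<open>Subtracting \<open>edges G\<close> covers the case that the pair is already an
    edge, so that only new edges are counted.\<close>
  have "add_edges G ({(u, v)} - edges G) = add_edges G {(u, v)}"
    by (auto simp: add_edges_def)
  then show ?case
    using uv 0 by (intro exI[of _ "{(u, v)} - edges G"]) (auto simp: card_Diff_subset_Int intro!: uv(3))
next
  case (Suc k)
  interpret balanced_bipartite G P M by fact
  interpret fl: balanced_bipartite G M P by (rule flip)
  let ?T = "int (Suc (Suc k))"
  have "?T \<ge> 2" by simp
  then obtain u v where uv: "u \<in> P" "v \<in> M"
    "\<And>\<Z>. optimal ?T \<Z> \<Longrightarrow> \<exists>Z\<in>\<Z>. u \<in> Z \<and> v \<notin> nbhd G Z"
    "\<And>\<Z>. fl.optimal ?T \<Z> \<Longrightarrow> \<exists>Z\<in>\<Z>. v \<in> Z \<and> u \<notin> nbhd G Z"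
    using improving_edge[of ?T] Suc.prems by blast
  let ?e = "{(u, v)}"
  let ?G = "add_edges G ?e"
  have e: "?e \<subseteq> plus_side G \<times> minus_side G" using uv Suc.prems by auto
  have T: "?T - 1 = int (Suc k)" by simp
  have "\<exists>F. F \<subseteq> P \<times> M - edges ?G \<and> card F \<le> Suc k
           \<and> balanced_bipartite.irreducible (add_edges ?G F) P"
  proof (rule Suc.IH)
    show "balanced_bipartite ?G P M" by (rule add_edges_balanced[OF e])
    show "P = plus_side ?G" "M = minus_side ?G" "P \<noteq> {}"
      using Suc.prems by (auto simp: add_edges_def)
    show "balanced_bipartite.bounded ?G P (int (Suc k))"
      using bounded_add_edge[OF Suc.prems(5) uv(1,2) disjI1[OF refl] e uv(3)] unfolding T .
    \<comment> \<open>Seen from the minus side the endpoints swap roles, hence the other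
      orientation.\<close>
    show "balanced_bipartite.bounded ?G M (int (Suc k))"
      using fl.bounded_add_edge[OF Suc.prems(6) uv(2,1) disjI2[OF refl] e uv(4)] unfolding T .
  qed
  then obtain F where F: "F \<subseteq> P \<times> M - edges ?G" "card F \<le> Suc k"
    "balanced_bipartite.irreducible (add_edges ?G F) P" by blast
  have "add_edges ?G F = add_edges G (insert (u, v) F - edges G)"
    by (auto simp: add_edges_def)
  moreover have "finite F" using F(1) fin by (meson finite_Diff finite_SigmaI finite_subset)
  then have "card (insert (u, v) F - edges G) \<le> Suc (Suc k)"
    using F(2) card_mono[of "insert (u, v) F" "insert (u, v) F - edges G"]
    by (auto simp: card_insert_if split: if_splits)
  ultimately show ?case
    using F uv by (intro exI[of _ "insert (u, v) F - edges G"]) auto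
qed

section \<open>The DM-decomposition\<close>

text \<open>Minimizers of the surplus are maximizers of the excess. Irreducibility says that these
  are exactly the empty set and the whole plus side, which is the chain with
  \<open>V\<^sub>1 = V\<close>; balance and size exclude \<open>V\<^sub>0 = V\<close> and
  \<open>V\<^sub>\<infinity> = V\<close>.\<close>

lemma DM_irreducible_iff:
  assumes "balanced_bipartite G (plus_side G) (minus_side G)" "card (plus_side G) \<ge> 2"
  shows "DM_irreducible G \<longleftrightarrow> balanced_bipartite.irreducible G (plus_side G)"
proof -
  define P where "P = plus_side G"
  define M where "M = minus_side G"
  note PM = P_def M_def
  interpret balanced_bipartite G P M using assms(1) by (simp add: PM)
  have PM0: "card P > 0" "P \<noteq> {}" using assms(2) by (auto simp: PM)
  have surplus: "surplus G X = 1 - excess G X" for X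
    by (simp add: surplus_def excess_def)
  define \<M> where "\<M> = surplus_minimizers G"
  have \<M>: "X \<in> \<M> \<longleftrightarrow> X \<subseteq> P \<and> (\<forall>Y\<subseteq>P. excess G Y \<le> excess G X)" for X
    by (auto simp: \<M>_def surplus_minimizers_def surplus PM)
  have maxchain_memI: "X \<in> C"
    if "subset.maxchain \<M> C" "X \<in> \<M>" "\<And>Y. Y \<in> C \<Longrightarrow> X \<subseteq> Y \<or> Y \<subseteq> X" for C X
  proof (rule ccontr)
    assume "X \<notin> C"
    have "subset.chain \<M> (insert X C)"
      using that unfolding subset.maxchain_def subset_chain_def by auto
    then show False using that(1) \<open>X \<notin> C\<close> unfolding subset.maxchain_def by blast
  qed
  \<comment> \<open>If the maximal excess is 1, the empty set attains it, and so does
    \<open>P\<close>, whose excess is at least 1.\<close>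
  have minimal: "{} \<in> \<M> \<and> P \<in> \<M>" if "X \<in> \<M>" "excess G X = 1" for X
  proof -
    have "excess G Y \<le> 1" if "Y \<subseteq> P" for Y
      using \<open>X \<in> \<M>\<close> that unfolding \<M> \<open>excess G X = 1\<close> by simp
    moreover from this have "excess G Y \<le> excess G P" if "Y \<subseteq> P" for Y
      using that excess_side_ge by (meson order_trans)
    ultimately show ?thesis by (simp add: \<M>)
  qed
  show ?thesis unfolding PM[symmetric]
  proof
    assume irr: irreducible
    \<comment> \<open>Already \<open>P\<close> minus one vertex, being proper and nonempty, must
      have at least \<open>card P = card M\<close> neighbours, hence all of
      \<open>M\<close>.\<close>
    have excess_P: "excess G P = 1 \<and> nbhd G P = M"
    proof -
      obtain a where a: "a \<in> P" using PM0 by blast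
      have "card (P - {a}) = card P - 1" using a fin by simp
      then have "P - {a} \<noteq> {}"
        using assms(2) by (metis One_nat_def PM(1) Suc_1 card.empty diff_is_0_eq not_less_eq_eq)
      then have "excess G (P - {a}) \<le> 0" using irreducibleD[OF irr, of "P - {a}"] a by blast
      then have "card (nbhd G (P - {a})) \<ge> card M"
        using \<open>card (P - {a}) = card P - 1\<close> PM0 card_eq unfolding excess_def by linarith
      moreover have "nbhd G (P - {a}) \<subseteq> M" by (rule nbhd_subset) auto
      ultimately have "nbhd G (P - {a}) = M" using card_seteq[OF fin(2)] by blast
      then have "nbhd G P = M" using nbhd_mono[of "P - {a}" P G] nbhd_subset[of P] by auto
      then show ?thesis using card_eq by (simp add: excess_def)
    qed
    have "X \<in> \<M> \<longleftrightarrow> X = {} \<or> X = P" for X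
    proof
      assume "X \<in> \<M>"
      then have "X \<subseteq> P" "excess G X \<ge> excess G P" unfolding \<M> by simp_all
      then show "X = {} \<or> X = P" using irreducibleD[OF irr, of X] excess_P by (auto simp: psubset_eq)
    next
      have le1: "excess G Y \<le> 1" if "Y \<subseteq> P" for Y
      proof (cases "Y = {} \<or> Y = P")
        case False
        then show ?thesis using irreducibleD[OF irr, of Y] that by (simp add: psubset_eq)
      qed (use excess_P in auto)
      show "X \<in> \<M>" if "X = {} \<or> X = P" using that excess_P le1 by (auto simp: \<M>)
    qed
    then have "\<M> = {{}, P}" by blast
    then have "subset.maxchain \<M> (set [{}, P])"
      unfolding subset.maxchain_def subset_chain_def by auto
    then have "maximal_minimizer_chain G [{}, P]"
      using PM0 by (auto simp: maximal_minimizer_chain_def \<M>_def)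
    moreover have "DM_parts G [{}, P] = [{}, P \<union> M, {}]"
      using excess_P
      by (simp add: DM_parts_def DM_first_def DM_middle_def DM_last_def PM[symmetric])
    moreover have "\<exists>!i. i < length [{}, P \<union> M, {}] \<and> [{}, P \<union> M, {}] ! i \<noteq> {}"
      using PM0 by (intro ex1I[of _ 1]) (auto simp: nth_Cons' less_Suc_eq split: if_splits)
    ultimately show "DM_irreducible G" unfolding DM_irreducible_def by metis
  next
    assume "DM_irreducible G"
    then obtain Xs where Xs: "sorted_wrt (\<subset>) Xs" "subset.maxchain \<M> (set Xs)"
      and ex1: "\<exists>!i. i < length (DM_parts G Xs) \<and> DM_parts G Xs ! i \<noteq> {}"
      unfolding DM_irreducible_def maximal_minimizer_chain_def \<M>_def by blast
    have sub: "set Xs \<subseteq> \<M>" using Xs(2) unfolding subset.maxchain_def subset_chain_def by blast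
    \<comment> \<open>A minimizer exists by finiteness, so a maximal chain cannot be empty.\<close>
    obtain X0 where X0: "X0 \<in> \<M>"
    proof -
      have "finite (excess G ` Pow P)" using fin by simp
      moreover from this have "Max (excess G ` Pow P) \<in> excess G ` Pow P" by (intro Max_in) auto
      ultimately show ?thesis using that unfolding \<M> by (smt (verit) Max_ge Pow_iff imageE imageI)
    qed
    then have ne: "Xs \<noteq> []" using maxchain_memI[OF Xs(2) X0] by auto
    have len: "length (DM_parts G Xs) = Suc (length Xs)"
      using ne by (cases Xs) (auto simp: DM_parts_def simp del: upt_Suc)
    have first: "DM_parts G Xs ! 0 = DM_first G Xs" by (simp add: DM_parts_def)
    have last: "DM_parts G Xs ! length Xs = DM_last G Xs"
      using ne by (cases Xs) (auto simp: DM_parts_def nth_append simp del: upt_Suc)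
    have middle: "DM_parts G Xs ! i = DM_middle G Xs i" if "1 \<le> i" "i < length Xs" for i
      using that by (cases i) (auto simp: DM_parts_def nth_append simp del: upt_Suc)
    \<comment> \<open>The chain is strictly increasing, so with a single nonempty part it has at
      most one middle part.\<close>
    have middle_ne: "DM_parts G Xs ! i \<noteq> {}" if "1 \<le> i" "i < length Xs" for i
    proof -
      have "Xs ! (i - 1) \<subset> Xs ! i" using sorted_wrt_nth_less[OF Xs(1), of "i - 1" i] that by simp
      then show ?thesis using middle[OF that] by (auto simp: DM_middle_def)
    qed
    have unique: "i = j" if "i < Suc (length Xs)" "j < Suc (length Xs)"
      "DM_parts G Xs ! i \<noteq> {}" "DM_parts G Xs ! j \<noteq> {}" for i j
      using ex1 that len by metis
    \<comment> \<open>With one member \<open>X\<close>, an empty end part forces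
      \<open>excess G X = 1\<close>. Then the empty set and \<open>P\<close> are minimizers
      comparable to \<open>X\<close>, so both belong to the chain, which has only one
      member.\<close>
    have "length Xs \<noteq> 1"
    proof
      assume l: "length Xs = 1"
      then obtain X where X: "Xs = [X]" by (auto simp: length_Suc_conv)
      then have XM: "X \<in> \<M>" using sub by simp
      have "DM_first G Xs = {} \<or> DM_last G Xs = {}" using unique[of 0 1] first last l by auto
      then have "X = {} \<or> X = P \<and> M \<subseteq> nbhd G X"
        using XM X unfolding DM_first_def DM_last_def \<M> by (auto simp: PM)
      then have "excess G X = 1"
      proof
        assume "X = P \<and> M \<subseteq> nbhd G X"
        then have "X = P" "nbhd G X = M" using nbhd_subset[of P] by auto
        then show ?thesis using card_eq by (simp add: excess_def)
      qed simp
      then have EM: "{} \<in> \<M>" and PM': "P \<in> \<M>" using minimal XM by auto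
      have "X \<subseteq> P" using XM by (simp add: \<M>)
      then have "{} \<in> set Xs" "P \<in> set Xs"
        using maxchain_memI[OF Xs(2) EM] maxchain_memI[OF Xs(2) PM'] X by auto
      then show False using X PM0 by auto
    qed
    moreover have "\<not> length Xs \<ge> 3"
    proof
      assume "length Xs \<ge> 3"
      then have "(1::nat) = 2" by (intro unique middle_ne) auto
      then show False by simp
    qed
    ultimately have l: "length Xs = 2" using ne by (cases "length Xs" rule: nat.exhaust) auto
    then obtain X Y where XY: "Xs = [X, Y]" by (auto simp: length_Suc_conv numeral_2_eq_2)
    have "DM_first G Xs = {}" "DM_last G Xs = {}"
      using unique[of 0 1] unique[of 2 1] middle_ne[of 1] first last l by auto
    then have "X = {}" "P \<subseteq> Y" using XY by (auto simp: DM_first_def DM_last_def PM)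
    moreover have "X \<in> \<M>" "Y \<in> \<M>" using sub XY by auto
    ultimately have set: "set Xs = {{}, P}" and "{} \<in> \<M>" using XY unfolding \<M> by auto
    then have le: "excess G Z \<le> 1" if "Z \<subseteq> P" for Z using that unfolding \<M> by auto
    have "excess G Z \<le> 0" if Z: "Z \<subset> P" "Z \<noteq> {}" for Z
    proof (rule ccontr)
      assume "\<not> excess G Z \<le> 0"
      then have "excess G Z = 1" using le[of Z] Z by auto
      \<comment> \<open>Such a \<open>Z\<close> lies strictly between the two members and could be
        inserted into the maximal chain.\<close>
      then have "Z \<in> \<M>" using Z le by (simp add: \<M> psubset_eq)
      then have "Z \<in> set Xs" using maxchain_memI[OF Xs(2), of Z] Z by (auto simp: set)
      then show False using Z by (auto simp: set)
    qed
    then show irreducible by (simp add: irreducible_def)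
  qed
qed

section \<open>The min-max formula\<close>

theorem theorem1p1:
  fixes G :: "'v bigraph"
  assumes "bipartite_graph G"
    and "card (plus_side G) = card (minus_side G)"
    and "card (plus_side G) \<ge> 2"
  shows "int (opt G) =
    Max {tau G \<X> | \<X>. proper_subpartition (plus_side G) \<X> \<or>
                        proper_subpartition (minus_side G) \<X>}"
proof -
  let ?P = "plus_side G" and ?M = "minus_side G"
  interpret balanced_bipartite G ?P ?M using assms by unfold_locales auto
  interpret fl: balanced_bipartite G ?M ?P by (rule flip)
  define \<T> where "\<T> = {tau G \<X> | \<X>. proper_subpartition ?P \<X> \<or> proper_subpartition ?M \<X>}"
  define C where "C = {F. F \<subseteq> ?P \<times> ?M - edges G \<and> DM_irreducible (add_edges G F)}"
  have P0: "?P \<noteq> {}" using assms(3) by auto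
  have "\<T> \<subseteq> tau G ` (Pow (Pow ?P) \<union> Pow (Pow ?M))"
    by (auto simp: \<T>_def proper_subpartition_def subpartition_def)
  then have fin\<T>: "finite \<T>" by (rule finite_subset) (simp add: fin)
  have \<T>I: "tau G \<X> \<le> Max \<T>" if "proper_subpartition ?P \<X> \<or> proper_subpartition ?M \<X>" for \<X>
    using fin\<T> that by (intro Max_ge) (auto simp: \<T>_def)
  have irr: "DM_irreducible (add_edges G F) \<longleftrightarrow> balanced_bipartite.irreducible (add_edges G F) ?P"
    if "F \<subseteq> ?P \<times> ?M" for F
  proof -
    have "plus_side (add_edges G F) = ?P" "minus_side (add_edges G F) = ?M"
      by (simp_all add: add_edges_def)
    then show ?thesis
      using DM_irreducible_iff[of "add_edges G F"] add_edges_balanced[OF that] assms(3) by simp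
  qed
  have empty: "proper_subpartition ?P {}" by (simp add: proper_subpartition_def subpartition_def)
  then have \<T>0: "tau G {} \<in> \<T>" by (auto simp: \<T>_def)
  \<comment> \<open>The empty family has value 0; this matches the case in which no edge has to be
    added.\<close>
  have M0: "Max \<T> \<ge> 0" using \<T>I[of "{}"] empty by (simp add: tau_def)
  have lower: "Max \<T> \<le> int (card F)" if "F \<in> C" for F
  proof -
    have F: "F \<subseteq> ?P \<times> ?M" using that by (auto simp: C_def)
    interpret G': balanced_bipartite "add_edges G F" ?P ?M by (rule add_edges_balanced[OF F])
    have "G'.irreducible" using irr[OF F] that by (simp add: C_def)
    moreover from this have "balanced_bipartite.irreducible (add_edges G F) ?M"
      using G'.irreducible_flip assms(3) by blast
    ultimately have "t \<le> int (card F)" if "t \<in> \<T>" for t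
      using that tau_le_card[OF F] fl.tau_le_card[OF F] by (auto simp: \<T>_def)
    then show ?thesis using fin\<T> \<T>0 by (intro Max.boundedI) auto
  qed
  have upper: "\<exists>F\<in>C. int (card F) \<le> Max \<T>"
  proof (cases irreducible)
    case True
    have "add_edges G {} = G" by (simp add: add_edges_def)
    then have "{} \<in> C" using True irr[of "{}"] by (simp add: C_def)
    then show ?thesis using M0 by (intro bexI[of _ "{}"]) auto
  next
    case False
    then obtain X where X: "X \<subset> ?P" "X \<noteq> {}" "\<not> excess G X \<le> 0"
      unfolding irreducible_def by blast
    then have "proper_subpartition ?P {X}"
      by (auto simp: proper_subpartition_def intro!: subpartition_single)
    then have M1: "Max \<T> \<ge> 1" using \<T>I[of "{X}"] X(3) by (simp add: tau_single)
    \<comment> \<open>The edge-adding argument needs a bound for all subpartitions, so the improper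
      ones are compared with the maximum over the proper ones.\<close>
    have "tau G {?P} \<le> Max \<T>"
      unfolding tau_single by (rule excess_side_le[OF assms(3) M1]) (simp add: \<T>I)
    then have "tau G \<X> \<le> Max \<T>" if "subpartition ?P \<X>" for \<X>
      using that \<T>I[of \<X>] by (cases "\<X> = {?P}") (simp_all add: proper_subpartition_def)
    then have bP: "bounded (Max \<T>)" by (simp add: bounded_def)
    have "card ?M \<ge> 2" using assms(2,3) by simp
    then have "tau G {?M} \<le> Max \<T>"
      unfolding tau_single by (rule fl.excess_side_le[OF _ M1]) (simp add: \<T>I)
    then have "tau G \<X> \<le> Max \<T>" if "subpartition ?M \<X>" for \<X>
      using that \<T>I[of \<X>] by (cases "\<X> = {?M}") (simp_all add: proper_subpartition_def)
    then have bM: "fl.bounded (Max \<T>)" by (simp add: fl.bounded_def)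
    define k where "k = nat (Max \<T> - 1)"
    have k: "Max \<T> = int (Suc k)" using M1 by (simp add: k_def)
    obtain F where F: "F \<subseteq> ?P \<times> ?M - edges G" "card F \<le> Suc k"
      "balanced_bipartite.irreducible (add_edges G F) ?P"
      using irreducible_augmentation[OF balanced_bipartite_axioms refl refl P0]
        bP[unfolded k] bM[unfolded k] by blast
    then have "F \<in> C" using irr[of F] by (auto simp: C_def)
    moreover have "int (card F) \<le> Max \<T>" unfolding k using F(2) by simp
    ultimately show ?thesis by blast
  qed
  then obtain F where F: "F \<in> C" "int (card F) \<le> Max \<T>" by blast
  have "C \<subseteq> Pow (?P \<times> ?M)" by (auto simp: C_def)
  then have "finite C" by (rule finite_subset) (simp add: fin)
  then have "Min (card ` C) = card F"
  proof (intro Min_eqI)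
    fix c assume "c \<in> card ` C"
    then obtain F' where "F' \<in> C" "c = card F'" by blast
    then show "card F \<le> c" using lower[of F'] F(2) by simp
  qed (use F(1) in auto)
  moreover have "opt G = Min (card ` C)"
    unfolding opt_def C_def by (rule arg_cong[of _ _ Min]) auto
  ultimately show ?thesis using F lower[OF F(1)] unfolding \<T>_def by simp
qed

end
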